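(* Let $c>0$, $\eta\ge 0$, $q\ge 0$ and fix a class $i$. Suppose the family $\mathcal{M}'_\eta(S_i^{\mathrm{good}}\cap D_{\mathrm{overlap}},\mathcal{F})$ satisfies $(c,q,\eta)$-robust expansion on $(S_i^{\mathrm{bad}}\cap D_{\mathrm{hard\,only}},\ S_i^{\mathrm{good}}\cap D_{\mathrm{overlap}})$. Let $f\in\mathcal{F}$ be an arbitrary classifier such that $$\mathbb{P}\big(f(\mathbf{x})\neq f_{\mathrm{weak}}(\mathbf{x})\ \text{or}\ f\ \text{is not } \eta\text{-robust at } \mathbf{x}\ \big|\ S_i\cap D_{\mathrm{overlap}}\big)\le 1-q-\varepsilon_1 .$$ Then $$\mathrm{err}(f,y\mid S_i\cap D_{\mathrm{hard\,only}})\le \mathrm{err}(f,f_{\mathrm{weak}}\mid S_i\cap D_{\mathrm{hard\,only}})+\varepsilon_2-2c\,\varepsilon_2\Big(1-\mathrm{err}(f,f_{\mathrm{weak}}\mid S_i^{\mathrm{good}}\cap D_{\mathrm{overlap}})-\mathbb{P}\big(R_\eta(f)^c\mid S_i^{\mathrm{good}}\cap D_{\mathrm{overlap}}\big)\Big).$$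
   Context: $\mathcal{X}$ is a finite input space, $\mathcal{Y}=\{1,\dots,k\}$, and $\mathbf{x}$ is a random element of $\mathcal{X}$ with distribution $\mathcal{D}$; $\mathbb{P}$ refers to $\mathcal{D}$, and for sets, $\mathbb{P}(A\mid B)=\mathbb{P}(\mathbf{x}\in A\mid \mathbf{x}\in B)$. $y:\mathcal{X}\to\mathcal{Y}$ is the ground-truth labeler, $f_{\mathrm{weak}}:\mathcal{X}\to\mathcal{Y}\cup\{\varnothing\}$ is a pseudolabeler ($\varnothing$ means abstention), and $\mathcal{F}$ is a class of functions (classifiers) $\mathcal{X}\to\mathcal{Y}$ (the strong model hypothesis class). Covered points of class $i$: $S_i=\{x: f_{\mathrm{weak}}(x)\ne\varnothing,\ y(x)=i\}$; $S_i^{\mathrm{good}}=\{x\in S_i: f_{\mathrm{weak}}(x)=y(x)\}$, $S_i^{\mathrm{bad}}=S_i\setminus S_i^{\mathrm{good}}$. $\mathcal{X}$ is partitioned as $\mathcal{X}=D_{\mathrm{easy\,only}}\cup D_{\mathrm{hard\,only}}\cup D_{\mathrm{overlap}}$. Set $\varepsilon_1=\mathbb{P}(y(\mathbf{x})\ne f_{\mathrm{weak}}(\mathbf{x})\mid S_i\cap D_{\mathrm{easy\,only}})=\mathbb{P}(y(\mathbf{x})\ne f_{\mathrm{weak}}(\mathbf{x})\mid S_i\cap D_{\mathrm{overlap}})$ (the two are assumed equal) and $\varepsilon_2=\mathbb{P}(y(\mathbf{x})\ne f_{\mathrm{weak}}(\mathbf{x})\mid S_i\cap D_{\mathrm{hard\,only}})$;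 it is assumed that $0<\varepsilon_1\le\varepsilon_2\le 0.5$. The events conditioned on are taken to have positive probability. For functions $f,g$ on $\mathcal{X}$ and $U\subset\mathcal{X}$: $\mathrm{err}(f,g\mid U)=\mathbb{P}(f(\mathbf{x})\ne g(\mathbf{x})\mid \mathbf{x}\in U)$. $\mathcal{N}$ is a neighborhood function assigning to each $x\in\mathcal{X}$ a set $\mathcal{N}(x)\subset\mathcal{X}$, symmetric in the sense $x\in\mathcal{N}(x')\iff x'\in\mathcal{N}(x)$; for sets, $\mathcal{N}(A)=\bigcup_{x\in A}\mathcal{N}(x)$. For a classifier $f$, $r(f,x)=\mathbb{P}(f(\mathbf{x}')\ne f(x)\mid \mathbf{x}'\in\mathcal{N}(x))$ (with $r(f,x)=0$ if $\mathbb{P}(\mathcal{N}(x))=0$); $f$ is $\eta$-robust at $x$ if $r(f,x)\le\eta$, and $R_\eta(f)=\{x: r(f,x)\le\eta\}$, with complement $R_\eta(f)^c$. Edge weights: $w(x,x')=\mathbb{P}(x)\mathbb{P}(x')\mathbf{1}[x\in\mathcal{N}(x')]$, and $w(V,U)=\sum_{x\in V,x'\in U}w(x,x')$. The size of the $\eta$-robust neighborhood of $U$ in $A$ is $P_{1-\eta}(U,A)=\min_{V\subset\mathcal{X}}\{\mathbb{P}(V\mid A): w(V,U)\ge(1-\eta)\,w(\mathcal{N}(U),U)\}$. A collection $\mathcal{M}$ of subsets of $B$ satisfies $(c,q,\eta)$-robust expansion on $(A,B)$ if for all $U\in\mathcal{M}$ with $\mathbb{P}(U\mid B)>q$ one has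 $P_{1-\eta}(U,A)>c\,\mathbb{P}(U\mid B)$. For $B\subset\mathcal{X}$ and $f\in\mathcal{F}$, let $U(B,f)=\{x\in B: f(x)\ne y(x)\}$. The family of $\eta$-robust non-mistake sets is $\mathcal{M}'_\eta(B,\mathcal{F})=\{R_\eta(f)\cap(B\setminus U(B,f)): f\in\mathcal{F}\}$. *)

theory Defs
  imports "HOL-Probability.Probability"
begin

text \<open>
  The finite input space is a type of class \<open>finite\<close>, its distribution a \<open>pmf\<close> on it. Labels are
  natural numbers (constrained to \<open>{1..k}\<close> where they are used); a pseudolabeler returns
  \<open>Some\<close> of a label or abstains with \<open>None\<close>.

  Conditional probabilities are the library's \<open>cond_prob\<close>, whose value is 0 when the
  conditioning event has probability 0.
\<close>

definition cprob :: "'x pmf \<Rightarrow> 'x set \<Rightarrow> 'x set \<Rightarrow> real" where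
  "cprob D A B = \<P>(x in measure_pmf D. x \<in> A \<bar> x \<in> B)"

definition err :: "'x pmf \<Rightarrow> ('x \<Rightarrow> 'a) \<Rightarrow> ('x \<Rightarrow> 'a) \<Rightarrow> 'x set \<Rightarrow> real" where
  "err D f g U = \<P>(x in measure_pmf D. f x \<noteq> g x \<bar> x \<in> U)"

definition covered :: "('x \<Rightarrow> nat) \<Rightarrow> ('x \<Rightarrow> nat option) \<Rightarrow> nat \<Rightarrow> 'x set" where
  "covered y fweak i = {x. fweak x \<noteq> None \<and> y x = i}"

definition covered_good :: "('x \<Rightarrow> nat) \<Rightarrow> ('x \<Rightarrow> nat option) \<Rightarrow> nat \<Rightarrow> 'x set" where
  "covered_good y fweak i = {x \<in> covered y fweak i. fweak x = Some (y x)}"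

definition covered_bad :: "('x \<Rightarrow> nat) \<Rightarrow> ('x \<Rightarrow> nat option) \<Rightarrow> nat \<Rightarrow> 'x set" where
  "covered_bad y fweak i = covered y fweak i - covered_good y fweak i"

text \<open>If the neighborhood has probability 0, the following value is 0.\<close>

definition local_dis :: "'x pmf \<Rightarrow> ('x \<Rightarrow> 'x set) \<Rightarrow> ('x \<Rightarrow> 'a) \<Rightarrow> 'x \<Rightarrow> real" where
  "local_dis D N f x = \<P>(x' in measure_pmf D. f x' \<noteq> f x \<bar> x' \<in> N x)"

definition robust_set :: "'x pmf \<Rightarrow> ('x \<Rightarrow> 'x set) \<Rightarrow> real \<Rightarrow> ('x \<Rightarrow> 'a) \<Rightarrow> 'x set" where
  "robust_set D N \<eta> f = {x. local_dis D N f x \<le> \<eta>}"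

definition edge_weight :: "'x pmf \<Rightarrow> ('x \<Rightarrow> 'x set) \<Rightarrow> 'x \<Rightarrow> 'x \<Rightarrow> real" where
  "edge_weight D N x x' = pmf D x * pmf D x' * of_bool (x \<in> N x')"

definition set_weight :: "'x pmf \<Rightarrow> ('x \<Rightarrow> 'x set) \<Rightarrow> 'x set \<Rightarrow> 'x set \<Rightarrow> real" where
  "set_weight D N V U = (\<Sum>x\<in>V. \<Sum>x'\<in>U. edge_weight D N x x')"

text \<open>
  The minimum ranges over a finite set, which for \<open>\<eta> \<ge> 0\<close> is nonempty since \<open>V = UNIV\<close> qualifies.
\<close>

definition robust_nbhd_size ::
  "('x::finite) pmf \<Rightarrow> ('x \<Rightarrow> 'x set) \<Rightarrow> real \<Rightarrow> 'x set \<Rightarrow> 'x set \<Rightarrow> real" where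
  "robust_nbhd_size D N \<eta> U A =
     Min {cprob D V A | V. set_weight D N V U \<ge> (1 - \<eta>) * set_weight D N (\<Union>x\<in>U. N x) U}"

definition robust_expansion ::
  "('x::finite) pmf \<Rightarrow> ('x \<Rightarrow> 'x set) \<Rightarrow> real \<Rightarrow> real \<Rightarrow> real \<Rightarrow> 'x set set \<Rightarrow> 'x set \<Rightarrow> 'x set \<Rightarrow> bool"
where
  "robust_expansion D N c q \<eta> \<M> A B \<longleftrightarrow>
     \<M> \<subseteq> Pow B \<and>
     (\<forall>U\<in>\<M>. cprob D U B > q \<longrightarrow> robust_nbhd_size D N \<eta> U A > c * cprob D U B)"

definition mistake_set :: "('x \<Rightarrow> nat) \<Rightarrow> 'x set \<Rightarrow> ('x \<Rightarrow> nat) \<Rightarrow> 'x set" where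
  "mistake_set y B f = {x \<in> B. f x \<noteq> y x}"

definition robust_non_mistake_sets ::
  "'x pmf \<Rightarrow> ('x \<Rightarrow> 'x set) \<Rightarrow> real \<Rightarrow> ('x \<Rightarrow> nat) \<Rightarrow> 'x set \<Rightarrow> ('x \<Rightarrow> nat) set \<Rightarrow> 'x set set"
where
  "robust_non_mistake_sets D N \<eta> y B F =
     {robust_set D N \<eta> f \<inter> (B - mistake_set y B f) | f. f \<in> F}"

end

theory Submission
  imports Defs
begin

text \<open>
  Let \<open>B\<close> be the set of good overlap points, \<open>U\<close> the subset on which \<open>f\<close> is correct and robust,
  and \<open>A\<close> the bad hard-only points. Robustness says that \<open>V = {x. f x = i}\<close> carries at least a
  fraction \<open>1 - \<eta>\<close> of the edge weight at \<open>U\<close>, so expansion bounds \<open>P(f = y | A)\<close> from below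
  by \<open>c * P(U | B)\<close>. On \<open>A\<close>, every point where \<open>f\<close> is correct is a disagreement with the
  pseudolabel, which turns one unit of gain into two.
  The expansion premise needs \<open>P(U | B) > q\<close>; it holds unless \<open>P(U | B) = 0\<close>, and in that case the
  claim is weaker than the triangle inequality for \<open>err\<close>.
\<close>

lemma cond_prob_pmf:
  "\<P>(x in measure_pmf D. P x \<bar> x \<in> B)
     = measure_pmf.prob D {x \<in> B. P x} / measure_pmf.prob D B"
  by (simp add: cond_prob_def conj_commute)

text \<open>Clears the denominator in \<open>local_dis\<close>. A null neighborhood is treated
  apart: there the quotient is 0 by convention and both sides vanish.\<close>

lemma prob_disagree_le_of_robust:
  assumes "x \<in> robust_set D N \<eta> f"
  shows "measure_pmf.prob D {x' \<in> N x. f x' \<noteq> f x} \<le> \<eta> * measure_pmf.prob D (N x)"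
proof (cases "measure_pmf.prob D (N x) = 0")
  case True
  have "measure_pmf.prob D {x' \<in> N x. f x' \<noteq> f x} \<le> measure_pmf.prob D (N x)"
    by (intro measure_pmf.finite_measure_mono) auto
  with True show ?thesis by simp
next
  case False
  then have "measure_pmf.prob D (N x) > 0"
    by (simp add: zero_less_measure_iff)
  with assms show ?thesis
    by (simp add: robust_set_def local_dis_def cond_prob_pmf pos_divide_le_eq)
qed

text \<open>Grouping the edges by their endpoint in \<open>U\<close> lets weights be compared one
  neighborhood at a time.\<close>

lemma set_weight_eq_sum_prob:
  fixes D :: "('x::finite) pmf"
  shows "set_weight D N V U = (\<Sum>x'\<in>U. pmf D x' * measure_pmf.prob D (V \<inter> N x'))"
proof -
  have "(\<Sum>x\<in>V. edge_weight D N x x') = pmf D x' * measure_pmf.prob D (V \<inter> N x')" for x'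
  proof -
    have "(\<Sum>x\<in>V. edge_weight D N x x') = (\<Sum>x\<in>V. if x \<in> N x' then pmf D x' * pmf D x else 0)"
      by (intro sum.cong) (auto simp: edge_weight_def)
    also have "\<dots> = (\<Sum>x\<in>V \<inter> N x'. pmf D x' * pmf D x)"
      by (simp add: sum.inter_restrict)
    also have "\<dots> = pmf D x' * measure_pmf.prob D (V \<inter> N x')"
      by (simp add: measure_measure_pmf_finite sum_distrib_left)
    finally show ?thesis .
  qed
  then show ?thesis
    unfolding set_weight_def by (subst sum.swap) simp
qed

text \<open>Around each robust \<open>x\<close> at most a fraction \<open>\<eta>\<close> of
  \<open>N x\<close> leaves the level set of \<open>f x\<close>. Since \<open>f\<close> is constant
  on \<open>U\<close>, one level set serves all these points, and summing with weights
  \<open>pmf D x\<close> gives the claim.\<close>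

lemma set_weight_level_set_ge:
  fixes D :: "('x::finite) pmf"
  assumes "U \<subseteq> robust_set D N \<eta> f" and "\<And>x. x \<in> U \<Longrightarrow> f x = a"
  shows "set_weight D N {x. f x = a} U \<ge> (1 - \<eta>) * set_weight D N (\<Union>x\<in>U. N x) U"
proof -
  have "(1 - \<eta>) * measure_pmf.prob D (N x) \<le> measure_pmf.prob D ({x. f x = a} \<inter> N x)"
    if "x \<in> U" for x
  proof -
    have "measure_pmf.prob D (N x)
        = measure_pmf.prob D ({x. f x = a} \<inter> N x) + measure_pmf.prob D {x' \<in> N x. f x' \<noteq> f x}"
      using assms(2)[OF that]
      by (subst measure_pmf.finite_measure_Union[symmetric])
        (auto intro!: arg_cong[where f = "measure_pmf.prob D"])
    moreover have "measure_pmf.prob D {x' \<in> N x. f x' \<noteq> f x} \<le> \<eta> * measure_pmf.prob D (N x)"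
      using assms(1) that by (intro prob_disagree_le_of_robust) auto
    ultimately show ?thesis by (simp add: algebra_simps)
  qed
  then have "(\<Sum>x\<in>U. pmf D x * ((1 - \<eta>) * measure_pmf.prob D (N x)))
      \<le> (\<Sum>x\<in>U. pmf D x * measure_pmf.prob D ({x. f x = a} \<inter> N x))"
    by (intro sum_mono mult_left_mono) auto
  \<comment> \<open>For \<open>x\<close> in \<open>U\<close> the union contains all of
    \<open>N x\<close>, so intersecting with it changes nothing.\<close>
  moreover have "set_weight D N (\<Union>x\<in>U. N x) U = (\<Sum>x\<in>U. pmf D x * measure_pmf.prob D (N x))"
    unfolding set_weight_eq_sum_prob
    by (intro sum.cong refl arg_cong2[where f = "(*)"] arg_cong[where f = "measure_pmf.prob D"]) auto
  ultimately show ?thesis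
    by (simp add: set_weight_eq_sum_prob sum_distrib_left mult.left_commute)
qed

lemma robust_nbhd_size_le:
  fixes D :: "('x::finite) pmf"
  assumes "set_weight D N V U \<ge> (1 - \<eta>) * set_weight D N (\<Union>x\<in>U. N x) U"
  shows "robust_nbhd_size D N \<eta> U A \<le> cprob D V A"
  unfolding robust_nbhd_size_def using assms by (intro Min_le) auto

theorem theoremD1:
  fixes D :: "('x::finite) pmf"
    and k i :: nat
    and y f :: "'x \<Rightarrow> nat"
    and fweak :: "'x \<Rightarrow> nat option"
    and F :: "('x \<Rightarrow> nat) set"
    and D_easy D_hard D_overlap :: "'x set"
    and N :: "'x \<Rightarrow> 'x set"
    and c q \<eta> \<epsilon>1 \<epsilon>2 :: real
  assumes "range y \<subseteq> {1..k}"
    and "range fweak \<subseteq> insert None (Some ` {1..k})"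
    and "\<And>g. g \<in> F \<Longrightarrow> range g \<subseteq> {1..k}"
    and "i \<in> {1..k}"
    and "D_easy \<union> D_hard \<union> D_overlap = UNIV"
    and "D_easy \<inter> D_hard = {}" and "D_easy \<inter> D_overlap = {}" and "D_hard \<inter> D_overlap = {}"
    and "\<And>x x'. x \<in> N x' \<longleftrightarrow> x' \<in> N x"
    and "measure_pmf.prob D (covered y fweak i \<inter> D_easy) > 0"
    and "measure_pmf.prob D (covered y fweak i \<inter> D_hard) > 0"
    and "measure_pmf.prob D (covered y fweak i \<inter> D_overlap) > 0"
    and "measure_pmf.prob D (covered_good y fweak i \<inter> D_overlap) > 0"
    and "measure_pmf.prob D (covered_bad y fweak i \<inter> D_hard) > 0"
    and "\<epsilon>1 = \<P>(x in measure_pmf D. Some (y x) \<noteq> fweak x \<bar> x \<in> covered y fweak i \<inter> D_easy)"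
    and "\<epsilon>1 = \<P>(x in measure_pmf D. Some (y x) \<noteq> fweak x \<bar> x \<in> covered y fweak i \<inter> D_overlap)"
    and "\<epsilon>2 = \<P>(x in measure_pmf D. Some (y x) \<noteq> fweak x \<bar> x \<in> covered y fweak i \<inter> D_hard)"
    and "0 < \<epsilon>1" and "\<epsilon>1 \<le> \<epsilon>2" and "\<epsilon>2 \<le> 0.5"
    and "c > 0" and "\<eta> \<ge> 0" and "q \<ge> 0"
    and "robust_expansion D N c q \<eta>
           (robust_non_mistake_sets D N \<eta> y (covered_good y fweak i \<inter> D_overlap) F)
           (covered_bad y fweak i \<inter> D_hard)
           (covered_good y fweak i \<inter> D_overlap)"
    and "f \<in> F"
    and "\<P>(x in measure_pmf D. Some (f x) \<noteq> fweak x \<or> x \<notin> robust_set D N \<eta> f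
           \<bar> x \<in> covered y fweak i \<inter> D_overlap) \<le> 1 - q - \<epsilon>1"
  shows "err D f y (covered y fweak i \<inter> D_hard)
     \<le> err D (Some \<circ> f) fweak (covered y fweak i \<inter> D_hard) + \<epsilon>2
       - 2 * c * \<epsilon>2 * (1 - err D (Some \<circ> f) fweak (covered_good y fweak i \<inter> D_overlap)
           - cprob D (- robust_set D N \<eta> f) (covered_good y fweak i \<inter> D_overlap))"
proof -
  let ?m = "measure_pmf.prob D"
  define S where "S = covered y fweak i"
  define A where "A = covered_bad y fweak i \<inter> D_hard"
  define B where "B = covered_good y fweak i \<inter> D_overlap"
  define R where "R = robust_set D N \<eta> f"
  define U where "U = {x \<in> B. f x = y x \<and> x \<in> R}"
  define H where "H = S \<inter> D_hard"
  define Ov where "Ov = S \<inter> D_overlap"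
  note defs = S_def A_def B_def U_def H_def Ov_def covered_def covered_good_def covered_bad_def
  have mH: "?m H > 0" and mO: "?m Ov > 0" and mB: "?m B > 0" and mA: "?m A > 0"
    using assms by (auto simp: S_def H_def Ov_def A_def B_def)
  have mono: "?m X \<le> ?m Y" if "X \<subseteq> Y" for X Y
    using that by (intro measure_pmf.finite_measure_mono) auto
  have split: "?m X = ?m Y + ?m Z" if "X = Y \<union> Z" "Y \<inter> Z = {}" for X Y Z
    using that by (simp add: measure_pmf.finite_measure_Union)
  have sub: "?m (X \<union> Y) \<le> ?m X + ?m Y" for X Y
    by (intro measure_Un_le) auto

  \<comment> \<open>The pseudolabel errors in \<open>H\<close> are exactly the points of
    \<open>A\<close>; likewise those in \<open>Ov\<close> are \<open>Ov - B\<close> below.\<close>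
  have e2: "?m A = \<epsilon>2 * ?m H"
  proof -
    have "{x \<in> H. Some (y x) \<noteq> fweak x} = A" by (auto simp: defs)
    then show ?thesis
      using assms(17) mH by (simp add: cond_prob_pmf flip: S_def H_def)
  qed
  have e1: "?m (Ov - B) = \<epsilon>1 * ?m Ov"
  proof -
    have "{x \<in> Ov. Some (y x) \<noteq> fweak x} = Ov - B" by (auto simp: defs)
    then show ?thesis
      using assms(16) mO by (simp add: cond_prob_pmf flip: S_def Ov_def)
  qed
  have B_Ov: "?m B = (1 - \<epsilon>1) * ?m Ov"
  proof -
    have "?m Ov = ?m B + ?m (Ov - B)"
      by (rule split) (auto simp: defs)
    with e1 show ?thesis by (simp add: algebra_simps)
  qed

  \<comment> \<open>A point of \<open>Ov\<close> outside \<open>?E\<close> is in \<open>U\<close> or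
    in \<open>Ov - B\<close>, and 1 - (1 - q - \<epsilon>1) - \<epsilon>1 = q.\<close>
  have U_lower: "?m U \<ge> q * ?m Ov"
  proof -
    let ?E = "{x \<in> Ov. Some (f x) \<noteq> fweak x \<or> x \<notin> R}"
    have "?m ?E \<le> (1 - q - \<epsilon>1) * ?m Ov"
      using assms(26) mO by (simp add: cond_prob_pmf pos_divide_le_eq flip: S_def Ov_def R_def)
    moreover have "?m Ov \<le> ?m (?E \<union> (U \<union> (Ov - B)))"
      by (intro mono) (auto simp: defs)
    moreover have "?m (?E \<union> (U \<union> (Ov - B))) \<le> ?m ?E + (?m U + ?m (Ov - B))"
      using sub[of ?E "U \<union> (Ov - B)"] sub[of U "Ov - B"] by linarith
    ultimately show ?thesis using e1 by (simp add: algebra_simps)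
  qed

  let ?u = "?m U / ?m B"
  let ?v = "1 - err D (Some \<circ> f) fweak B - cprob D (- R) B"
  \<comment> \<open>Union bound: on \<open>B\<close> the pseudolabel is correct, so a robust point
    where \<open>f\<close> agrees with it lies in \<open>U\<close>.\<close>
  have u_ge: "?v \<le> ?u"
  proof -
    let ?E = "{x \<in> B. (Some \<circ> f) x \<noteq> fweak x}" and ?F = "{x \<in> B. x \<in> - R}"
    have "?m B \<le> ?m (?E \<union> (?F \<union> U))"
      by (intro mono) (auto simp: defs)
    also have "\<dots> \<le> ?m ?E + (?m ?F + ?m U)"
      using sub[of ?E "?F \<union> U"] sub[of ?F U] by linarith
    finally have "?m B / ?m B \<le> (?m ?E + (?m ?F + ?m U)) / ?m B"
      using mB by (intro divide_right_mono) auto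
    then show ?thesis
      using mB by (simp add: err_def cprob_def cond_prob_pmf add_divide_distrib)
  qed

  define a where "a = ?m {x \<in> A. f x = i}"
  \<comment> \<open>Off \<open>A\<close> the pseudolabel is the true label, so errors and
    disagreements coincide there. On \<open>A\<close> the mass \<open>a\<close> where
    \<open>f\<close> is correct counts as disagreement but not as error, hence the factor 2.\<close>
  have gain: "?m {x \<in> H. f x \<noteq> y x} \<le> ?m {x \<in> H. (Some \<circ> f) x \<noteq> fweak x} + ?m A - 2 * a"
  proof -
    have 1: "?m {x \<in> H. f x \<noteq> y x} = ?m {x \<in> H - A. f x \<noteq> y x} + ?m {x \<in> A. f x \<noteq> i}"
      by (rule split) (auto simp: defs)
    have 2: "?m A = a + ?m {x \<in> A. f x \<noteq> i}"
      unfolding a_def by (rule split) auto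
    have "?m ({x \<in> H - A. f x \<noteq> y x} \<union> {x \<in> A. f x = i})
        = ?m {x \<in> H - A. f x \<noteq> y x} + a"
      unfolding a_def by (rule split) auto
    moreover have "?m ({x \<in> H - A. f x \<noteq> y x} \<union> {x \<in> A. f x = i})
        \<le> ?m {x \<in> H. (Some \<circ> f) x \<noteq> fweak x}"
      by (intro mono) (auto simp: defs)
    ultimately show ?thesis using 1 2 by linarith
  qed

  have key: "c * ?v * ?m A \<le> a"
  proof (cases "?u > q")
    case True
    have U_eq: "U = R \<inter> (B - mistake_set y B f)"
      by (auto simp: U_def mistake_set_def)
    have "U \<in> robust_non_mistake_sets D N \<eta> y B F"
      unfolding robust_non_mistake_sets_def U_eq R_def using assms(25) by blast
    moreover have "cprob D U B = ?u"
      by (simp add: cprob_def cond_prob_pmf U_def)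
    ultimately have "c * ?u < robust_nbhd_size D N \<eta> U A"
      using assms(24) True unfolding robust_expansion_def A_def B_def by metis
    \<comment> \<open>The level set of \<open>i\<close> is a candidate in the minimum: points of
      \<open>U\<close> have true label \<open>i\<close>, and \<open>f\<close> is correct on
      them.\<close>
    also have "\<dots> \<le> cprob D {x. f x = i} A"
      by (intro robust_nbhd_size_le set_weight_level_set_ge) (auto simp: defs R_def)
    also have "\<dots> = a / ?m A"
      by (simp add: cprob_def cond_prob_pmf a_def)
    finally have "c * ?u * ?m A < a"
      using mA by (simp add: pos_less_divide_eq)
    moreover have "c * ?v * ?m A \<le> c * ?u * ?m A"
      using u_ge mA assms(21) by (intro mult_right_mono mult_left_mono) auto
    ultimately show ?thesis by linarith
  next
    case False
    \<comment> \<open>Here \<open>U\<close> has mass at most \<open>q\<close> times that of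
      \<open>B\<close>, yet at least \<open>q\<close> times that of \<open>Ov\<close>. As
      \<open>B\<close> is smaller by the positive factor 1 - \<epsilon>1 < 1, this forces
      \<open>q\<close> = 0, and then \<open>?u\<close> and \<open>?v\<close> are
      nonpositive.\<close>
    then have "?m U \<le> q * ?m B"
      using mB by (simp add: pos_divide_le_eq not_less)
    with U_lower have "q * (\<epsilon>1 * ?m Ov) \<le> 0"
      unfolding B_Ov by (simp add: algebra_simps)
    moreover have "\<epsilon>1 * ?m Ov > 0" using mO assms(18) by simp
    ultimately have "q \<le> 0" by (meson mult_pos_pos not_less)
    with False have "?u \<le> 0" by linarith
    with u_ge have "?v \<le> 0" by linarith
    then have "c * ?v * ?m A \<le> 0"
      using assms(21) mA by (simp add: mult_nonneg_nonpos mult_nonpos_nonneg)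
    also have "0 \<le> a" by (simp add: a_def)
    finally show ?thesis .
  qed

  \<comment> \<open>Twice \<open>key\<close> bounds the term \<open>2 * a\<close> in
    \<open>gain\<close>; \<open>e2\<close> expresses the mass of \<open>A\<close> through that of
    \<open>H\<close>, by which the result is then divided.\<close>
  have "?m {x \<in> H. f x \<noteq> y x}
      \<le> ?m {x \<in> H. (Some \<circ> f) x \<noteq> fweak x} + \<epsilon>2 * ?m H - 2 * c * \<epsilon>2 * ?v * ?m H"
    using gain key unfolding e2 by (simp add: algebra_simps)
  then have "?m {x \<in> H. f x \<noteq> y x} / ?m H
      \<le> (?m {x \<in> H. (Some \<circ> f) x \<noteq> fweak x} + \<epsilon>2 * ?m H - 2 * c * \<epsilon>2 * ?v * ?m H) / ?m H"
    using mH by (intro divide_right_mono) auto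
  then have "err D f y H \<le> err D (Some \<circ> f) fweak H + \<epsilon>2 - 2 * c * \<epsilon>2 * ?v"
    using mH by (simp add: err_def cond_prob_pmf add_divide_distrib diff_divide_distrib)
  then show ?thesis
    by (simp add: H_def S_def B_def R_def)
qed

end
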